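(* Let $\{\mathcal M^{[s,t]}=(c_{ijk}^{[s,t]})_{i,j,k=1}^m:\ 0\le s\le t\}$ be a family of real cubic matrices satisfying the Kolmogorov-Chapman equation \[\mathcal M^{[s,t]}=\mathcal M^{[s,\tau]}\mathcal M^{[\tau,t]}\quad\text{for all } 0\le s<\tau<t\] with respect to the multiplication of type (D). Then $\{\mathcal M^{[s,t]}\}$ is a solution of the system \[\sum_{j=1}^m c_{ijk}^{[s,t]}=\bar c^{[s,t]}_{ik},\qquad i,k=1,\dots,m,\] for a family of $m\times m$ square matrices $\overline{\mathcal M}^{[s,t]}=(\bar c^{[s,t]}_{ik})_{i,k=1}^m$ which satisfies \[\overline{\mathcal M}^{[s,t]}=\overline{\mathcal M}^{[s,\tau]}\,\overline{\mathcal M}^{[\tau,t]}\quad\text{for all } 0\le s<\tau<t\] with respect to the usual product of square matrices.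
   Context: A cubic matrix of size $m$ is a real array $A=(a_{ijk})_{i,j,k=1}^m$. Multiplication of type (D): for cubic matrices $A=(a_{ijk})$, $B=(b_{ijk})$, the product $C=AB=(c_{ijr})$ has entries $c_{ijr}=\sum_{k,n=1}^m a_{ijk}b_{knr}$. *)

theory Defs
  imports "HOL-Analysis.Analysis"
begin

text \<open>A cubic matrix \<open>(a\<^sub>i\<^sub>j\<^sub>k)\<close> of size \<open>m = CARD('m)\<close>; the entry \<open>a\<^sub>i\<^sub>j\<^sub>k\<close> is \<open>A $ i $ j $ k\<close>.\<close>

type_synonym 'm cubic_matrix = "real ^ 'm ^ 'm ^ 'm"

definition cubic_mult_D ::
    "('m::finite) cubic_matrix \<Rightarrow> 'm cubic_matrix \<Rightarrow> 'm cubic_matrix"  (infixl "**\<^sub>D" 70)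
  where "A **\<^sub>D B = (\<chi> i j r. \<Sum>k\<in>UNIV. \<Sum>n\<in>UNIV. A $ i $ j $ k * B $ k $ n $ r)"

text \<open>A family indexed by \<open>0 \<le> s \<le> t\<close> is a total function of two real arguments
  whose values at other arguments are never constrained.\<close>

definition kolmogorov_chapman :: "('a \<Rightarrow> 'a \<Rightarrow> 'a) \<Rightarrow> (real \<Rightarrow> real \<Rightarrow> 'a) \<Rightarrow> bool"
  where "kolmogorov_chapman prod_op M \<longleftrightarrow>
    (\<forall>s \<tau> t. 0 \<le> s \<and> s < \<tau> \<and> \<tau> < t \<longrightarrow> M s t = prod_op (M s \<tau>) (M \<tau> t))"

end

theory Submission
  imports Defs
begin

text \<open>
  In the product of type (D) the middle index of the left factor survives untouched, while the
  middle index of the right factor is already summed out. Summing the product over its own middle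
  index therefore sums both factors over theirs, and the remaining contraction over \<open>k\<close> is the
  usual matrix product: the marginal map is multiplicative (\<open>marginal_cubic_mult_D\<close>).
  A multiplicative map sends solutions of the Kolmogorov-Chapman equation to solutions
  (\<open>kolmogorov_chapman_hom\<close>), so the marginals of the given family are the required square
  matrices.
\<close>

definition marginal :: "('m::finite) cubic_matrix \<Rightarrow> real ^ 'm ^ 'm"
  where "marginal A = (\<chi> i k. \<Sum>j\<in>UNIV. A $ i $ j $ k)"

lemma marginal_nth [simp]: "marginal A $ i $ k = (\<Sum>j\<in>UNIV. A $ i $ j $ k)"
  by (simp add: marginal_def)

text \<open>
  Each summand \<open>a\<^sub>i\<^sub>j\<^sub>k b\<^sub>k\<^sub>n\<^sub>r\<close> couples \<open>j\<close> and \<open>n\<close> only through \<open>k\<close>, so for fixed \<open>k\<close> the double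
  sum over \<open>j\<close> and \<open>n\<close> factors.
\<close>

lemma marginal_cubic_mult_D: "marginal (A **\<^sub>D B) = marginal A ** marginal B"
proof -
  have "marginal (A **\<^sub>D B) $ i $ r = (marginal A ** marginal B) $ i $ r" for i r
  proof -
    have "marginal (A **\<^sub>D B) $ i $ r
        = (\<Sum>j\<in>UNIV. \<Sum>k\<in>UNIV. \<Sum>n\<in>UNIV. A $ i $ j $ k * B $ k $ n $ r)"
      by (simp add: cubic_mult_D_def)
    also have "\<dots> = (\<Sum>k\<in>UNIV. \<Sum>j\<in>UNIV. \<Sum>n\<in>UNIV. A $ i $ j $ k * B $ k $ n $ r)"
      by (rule sum.swap)
    also have "\<dots> = (\<Sum>k\<in>UNIV. (\<Sum>j\<in>UNIV. A $ i $ j $ k) * (\<Sum>n\<in>UNIV. B $ k $ n $ r))"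
      by (simp add: sum_product)
    also have "\<dots> = (marginal A ** marginal B) $ i $ r"
      by (simp add: matrix_matrix_mult_def)
    finally show ?thesis .
  qed
  then show ?thesis
    by (simp add: vec_eq_iff del: marginal_nth)
qed

lemma kolmogorov_chapman_hom:
  assumes "kolmogorov_chapman f M" and "\<And>A B. h (f A B) = g (h A) (h B)"
  shows "kolmogorov_chapman g (\<lambda>s t. h (M s t))"
  unfolding kolmogorov_chapman_def
proof (intro allI impI)
  fix s \<tau> t :: real
  assume "0 \<le> s \<and> s < \<tau> \<and> \<tau> < t"
  with assms(1) have "M s t = f (M s \<tau>) (M \<tau> t)"
    unfolding kolmogorov_chapman_def by blast
  then show "h (M s t) = g (h (M s \<tau>)) (h (M \<tau> t))"
    by (simp only: assms(2))
qed

theorem proposition3: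
  fixes M :: "real \<Rightarrow> real \<Rightarrow> ('m::finite) cubic_matrix"
  assumes "kolmogorov_chapman (**\<^sub>D) M"
  shows "\<exists>Mbar :: real \<Rightarrow> real \<Rightarrow> real ^ 'm ^ 'm.
    kolmogorov_chapman (**) Mbar \<and>
    (\<forall>s t. 0 \<le> s \<and> s \<le> t \<longrightarrow> (\<forall>i k. (\<Sum>j\<in>UNIV. M s t $ i $ j $ k) = Mbar s t $ i $ k))"
proof (intro exI conjI)
  show "kolmogorov_chapman (**) (\<lambda>s t. marginal (M s t))"
    using assms marginal_cubic_mult_D by (rule kolmogorov_chapman_hom)
qed simp

end
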